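(* (Generalized Cameron-Martin formula.) Let $G$ be a locally convex Souslin topological vector space equipped with the Borel $\sigma$-algebra $\mathcal G$ and a basis $\{f_i\}_{i=1}^\infty$ such that the unique coefficients $y_i$ in $y=\sum_{i=1}^\infty y_if_i$ depend measurably on $y\in G$. Let a $G$-valued random variable $\varepsilon$ be of the form $\varepsilon=\sum_{i=1}^\infty\varepsilon_if_i$, where the random variables $\varepsilon_i$ are statistically independent and have probability density functions $\rho_i$ (with respect to the Lebesgue measure) that are a.e. positive. If $L(x)=\sum_{i=1}^\infty a_i(x)f_i$ for all $x\in F$, and, with $L_n(x)=\sum_{i=1}^na_i(x)f_i$, the densities $$\frac{d\mu_{\varepsilon+L_n(x)}}{d\mu_\varepsilon}(y)=\frac{\prod_{i=1}^n\rho_i(y_i-a_i(x))}{\prod_{i=1}^n\rho_i(y_i)},\quad n\in\mathbf N,$$ are uniformly integrable with respect to $\mu_\varepsilon$ and convergent $\mu_\varepsilon$-almost everywhere as $n\to\infty$, then $$\frac{d\mu_{\varepsilon+L(x)}}{d\mu_\varepsilon}(y)=\prod_{i=1}^\infty\frac{\rho_i(y_i-a_i(x))}{\rho_i(y_i)}$$ for $\mu_\varepsilon$-almost every $y=\sum_{i=1}^\infty y_if_i$.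
   Context: A Souslin space is a Hausdorff topological space that is the image of a complete separable metric space under a continuous mapping. $F$ is a locally convex Souslin topological vector space and $L:F\to G$ is a continuous mapping. $\mu_V$ denotes the image measure (distribution) of a random variable $V$; for $x\in F$, $\mu_{\varepsilon+L(x)}$ is the distribution of $\omega\mapsto\varepsilon(\omega)+L(x)$. The series $\sum_i\varepsilon_if_i$ converges almost surely in $G$. *)

theory Defs
  imports "HOL-Probability.Probability"
begin

class real_tvs = real_vector + topological_ab_group_add +
  assumes tendsto_scaleR_Pair:
    "LIM p (nhds (r::real) \<times>\<^sub>F nhds x). fst p *\<^sub>R snd p :> nhds (r *\<^sub>R x)"

text \<open>
  The constant \<^const>\<open>convex\<close> is not available in a class axiom, so its definition is spelled out
  there.
\<close>

class locally_convex_tvs = real_tvs +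
  assumes convex_nhds_zero_raw:
    "open U \<Longrightarrow> 0 \<in> U \<Longrightarrow>
      \<exists>V. open V \<and>
          (\<forall>x\<in>V. \<forall>y\<in>V. \<forall>u\<ge>0. \<forall>v\<ge>0. u + v = 1 \<longrightarrow> u *\<^sub>R x + v *\<^sub>R y \<in> V) \<and>
          0 \<in> V \<and> V \<subseteq> U"

lemma convex_nhds_zero:
  fixes U :: "'a::locally_convex_tvs set"
  assumes "open U" and "0 \<in> U"
  shows "\<exists>V. open V \<and> convex V \<and> 0 \<in> V \<and> V \<subseteq> U"
  using convex_nhds_zero_raw[OF assms] unfolding convex_def .

text \<open>
  A Hausdorff continuous image of a complete separable metric space. A class axiom cannot
  quantify over the type carrying the metric space, but fixing it to be \<open>nat \<Rightarrow> real\<close> is no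
  restriction: for a dense sequence \<open>(p k)\<close> in a metric space with distance \<open>d\<close>, the map sending
  \<open>z\<close> to \<open>(\<lambda>k. d z (p k))\<close> is injective, so every separable metric space is isometric to one
  carried by some subset of \<open>nat \<Rightarrow> real\<close>. The distance of \<open>m\<close> is arbitrary and unrelated to the
  product topology of \<open>nat \<Rightarrow> real\<close>. The term \<open>topology open\<close> is what \<open>euclidean\<close> abbreviates.
\<close>

class souslin_space = t2_space +
  assumes souslin:
    "\<exists>(m :: (nat \<Rightarrow> real) metric) h.
       mcomplete_of m \<and> separable_space (mtopology_of m) \<and>
       continuous_map (mtopology_of m) (topology open :: 'a topology) h \<and>
       h ` mspace m = (UNIV :: 'a set)"

text \<open>
  Continuity of the coefficient functionals is not part of the notion of a basis used here.
\<close>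

definition series_basis :: "(nat \<Rightarrow> 'a::real_tvs) \<Rightarrow> bool" where
  "series_basis f \<longleftrightarrow> (\<forall>y. \<exists>!c :: nat \<Rightarrow> real. (\<lambda>i. c i *\<^sub>R f i) sums y)"

definition coeffs_of :: "(nat \<Rightarrow> 'a::real_tvs) \<Rightarrow> 'a \<Rightarrow> nat \<Rightarrow> real" where
  "coeffs_of f y = (THE c. (\<lambda>i. c i *\<^sub>R f i) sums y)"

definition uniformly_integrable :: "'a measure \<Rightarrow> (nat \<Rightarrow> 'a \<Rightarrow> real) \<Rightarrow> bool" where
  "uniformly_integrable M p \<longleftrightarrow>
     (\<forall>n. integrable M (p n)) \<and>
     ((\<lambda>K::real. SUP n. \<integral>\<^sup>+ y. ennreal \<bar>p n y\<bar> * indicator {y. K < \<bar>p n y\<bar>} y \<partial>M) \<longlongrightarrow> 0) at_top"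

text \<open>
  \<open>N\<close> has the Radon-Nikodym derivative \<open>p\<close> with respect to \<open>M\<close>. Absolute continuity has to be
  stated because \<^const>\<open>RN_deriv\<close> is a total function, with value \<open>0\<close> when no density exists.
\<close>

definition has_RN_deriv :: "'a measure \<Rightarrow> 'a measure \<Rightarrow> ('a \<Rightarrow> real) \<Rightarrow> bool" where
  "has_RN_deriv M N p \<longleftrightarrow>
     absolutely_continuous M N \<and> (AE y in M. RN_deriv M N y = ennreal (p y))"

end

theory Submission
  imports Defs
begin

text \<open>
  In a locally convex Souslin space the indicator of every open set is a limit of continuous
  functions with values in \<open>[0, 1]\<close>: Minkowski gauges give enough continuous functions, and the space
  is hereditarily Lindelof. Finite Borel measures are therefore determined by their integrals of such
  functions \<open>g\<close>. For the truncated shift \<open>L\<^sub>n x\<close>, the identity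
  \<open>E g(\<epsilon> + L\<^sub>n x) = E p\<^sub>n(\<epsilon>) g(\<epsilon>)\<close> is a finite-dimensional change of variables
  when \<open>\<epsilon>\<close> is replaced by a partial sum of its series, and dominated convergence passes to \<open>\<epsilon>\<close>.
  For \<open>L x\<close>, uniform integrability shows that the limit \<open>p\<close> of the \<open>p\<^sub>n\<close> still has integral \<open>1\<close>, so
  that \<open>\<integral> p\<^sub>n g d\<mu>\<close> tends to \<open>\<integral> p g d\<mu>\<close>, while \<open>E g(\<epsilon> + L\<^sub>n x)\<close> tends to
  \<open>E g(\<epsilon> + L x)\<close> by continuity of \<open>g\<close>.
\<close>

subsection \<open>Borel measures on locally convex Souslin spaces\<close>

lemma tendsto_scaleR_tvs:
  fixes g :: "'a \<Rightarrow> 'b::real_tvs"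
  assumes "(f \<longlongrightarrow> r) F" and "(g \<longlongrightarrow> x) F"
  shows "((\<lambda>z. f z *\<^sub>R g z) \<longlongrightarrow> r *\<^sub>R x) F"
  using filterlim_compose[OF tendsto_scaleR_Pair filterlim_Pair[OF assms]] by simp

lemma continuous_on_scaleR_tvs:
  fixes g :: "'a::topological_space \<Rightarrow> 'b::real_tvs"
  assumes "continuous_on S f" and "continuous_on S g"
  shows "continuous_on S (\<lambda>z. f z *\<^sub>R g z)"
  using assms unfolding continuous_on_def by (auto intro: tendsto_scaleR_tvs)

text \<open>The function is \<open>max 0 (1 - q)\<close> for the Minkowski gauge \<open>q\<close> of
  \<open>V\<close>. Convexity makes the gauge subadditive, and since \<open>V\<close> is a
  neighbourhood of \<open>0\<close> the gauge is small near \<open>0\<close>; together these give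
  continuity everywhere.\<close>

lemma convex_open_bump:
  fixes V :: "'a::real_tvs set"
  assumes "open V" "convex V" "0 \<in> V"
  obtains g :: "'a \<Rightarrow> real"
  where "continuous_on UNIV g" "\<And>y. g y \<in> {0..1}" "g 0 > 0" "\<And>y. y \<notin> V \<Longrightarrow> g y = 0"
proof -
  define S where "S y = {t. 0 < t \<and> inverse t *\<^sub>R y \<in> V}" for y
  define q where "q y = Inf (S y)" for y  \<comment> \<open>the Minkowski gauge of \<open>V\<close>\<close>
  have bdd: "bdd_below (S y)" for y
    unfolding S_def bdd_below_def by (auto intro!: exI[of _ 0])
  \<comment> \<open>A neighbourhood of \<open>0\<close> absorbs every point, so the infimum defining
    \<open>q\<close> is never taken over the empty set.\<close>
  have ne: "S y \<noteq> {}" for y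
  proof -
    have "((\<lambda>n. inverse (real (Suc n)) *\<^sub>R y) \<longlongrightarrow> 0 *\<^sub>R y) sequentially"
      by (intro tendsto_scaleR_tvs LIMSEQ_inverse_real_of_nat tendsto_const)
    then have "eventually (\<lambda>n. inverse (real (Suc n)) *\<^sub>R y \<in> V) sequentially"
      using assms(1,3) by (intro topological_tendstoD) auto
    then obtain n where "inverse (real (Suc n)) *\<^sub>R y \<in> V"
      using eventually_happens'[OF sequentially_bot] by blast
    then have "real (Suc n) \<in> S y" by (simp add: S_def)
    then show ?thesis by blast
  qed
  have up: "s \<in> S y" if "t \<in> S y" "t \<le> s" for s t y
  proof -
    have "(t / s) *\<^sub>R (inverse t *\<^sub>R y) + (1 - t / s) *\<^sub>R 0 \<in> V"
      using that assms(2,3) unfolding S_def by (intro convexD) auto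
    then show ?thesis using that by (simp add: S_def field_simps)
  qed
  have add: "t + s \<in> S (y + z)" if "t \<in> S y" "s \<in> S z" for t s y z
  proof -
    have pos: "t > 0" "s > 0" using that by (auto simp: S_def)
    \<comment> \<open>This convex combination of \<open>y / t\<close> and \<open>z / s\<close> is
      \<open>(y + z) / (t + s)\<close>.\<close>
    have "(t / (t + s)) *\<^sub>R (inverse t *\<^sub>R y) + (s / (t + s)) *\<^sub>R (inverse s *\<^sub>R z) \<in> V"
      using that assms(2) pos unfolding S_def
      by (intro convexD) (auto simp: add_divide_distrib[symmetric])
    then show ?thesis using pos
      by (simp add: S_def scaleR_add_right inverse_eq_divide)
  qed
  have q_le: "q y \<le> t" if "t \<in> S y" for y t
    unfolding q_def using that bdd by (rule cInf_lower)
  have q_nonneg: "0 \<le> q y" for y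
    unfolding q_def using ne by (intro cInf_greatest) (auto simp: S_def)
  have q_add: "q (y + z) \<le> q y + s" if "s \<in> S z" for y z s
  proof -
    have "q (y + z) - s \<le> q y"
      unfolding q_def[of y] using ne
    proof (rule cInf_greatest)
      fix t assume "t \<in> S y"
      with q_le[OF add[OF this that]] show "q (y + z) - s \<le> t" by simp
    qed
    then show ?thesis by simp
  qed
  have cont: "(q \<longlongrightarrow> q y) (at y)" for y
  proof (rule tendstoI)
    fix e :: real assume "e > 0"
    \<comment> \<open>Membership in \<open>S\<close> bounds the gauge only weakly by
      \<open>d\<close>, hence a \<open>d\<close> strictly below \<open>e\<close>. As
      \<open>V\<close> need not be symmetric, the two sides of the estimate come separately from
      \<open>z - y\<close> and \<open>y - z\<close>.\<close>
    define d where "d = e / 2"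
    have d: "d > 0" "d < e" using \<open>e > 0\<close> by (auto simp: d_def)
    have "((\<lambda>z. inverse d *\<^sub>R (z - y)) \<longlongrightarrow> inverse d *\<^sub>R (y - y)) (at y)"
      by (intro tendsto_scaleR_tvs tendsto_diff tendsto_const tendsto_ident_at)
    then have 1: "\<forall>\<^sub>F z in at y. inverse d *\<^sub>R (z - y) \<in> V"
      using assms(1,3) by (intro topological_tendstoD) auto
    have "((\<lambda>z. inverse d *\<^sub>R (y - z)) \<longlongrightarrow> inverse d *\<^sub>R (y - y)) (at y)"
      by (intro tendsto_scaleR_tvs tendsto_diff tendsto_const tendsto_ident_at)
    then have 2: "\<forall>\<^sub>F z in at y. inverse d *\<^sub>R (y - z) \<in> V"
      using assms(1,3) by (intro topological_tendstoD) auto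
    from 1 2 show "\<forall>\<^sub>F z in at y. dist (q z) (q y) < e"
    proof eventually_elim
      case (elim z)
      then have "d \<in> S (z - y)" "d \<in> S (y - z)" using d by (auto simp: S_def)
      with q_add[of d "z - y" y] q_add[of d "y - z" z] d show ?case
        by (auto simp: dist_real_def)
    qed
  qed
  define g where "g y = max 0 (1 - q y)" for y
  show ?thesis
  proof (rule that)
    show "continuous_on UNIV g"
      unfolding g_def using cont by (intro continuous_intros) (simp add: continuous_on_def)
    show "g y \<in> {0..1}" for y using q_nonneg[of y] by (auto simp: g_def)
    have "1 / 2 \<in> S 0" using assms by (simp add: S_def)
    from q_le[OF this] show "g 0 > 0" by (simp add: g_def)
    fix y assume y: "y \<notin> V"
    \<comment> \<open>A scale below \<open>1\<close> in \<open>S y\<close> would put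
      \<open>1\<close> into \<open>S y\<close> by upward closure, that is, \<open>y\<close> into
      \<open>V\<close>.\<close>
    have "1 \<le> q y"
      unfolding q_def using ne
    proof (rule cInf_greatest)
      fix t assume t: "t \<in> S y"
      show "1 \<le> t"
      proof (rule ccontr)
        assume "\<not> 1 \<le> t"
        with up[OF t, of 1] y show False by (simp add: S_def)
      qed
    qed
    then show "g y = 0" by (simp add: g_def)
  qed
qed

text \<open>Translation by \<open>x\<close> reduces this to a neighbourhood of \<open>0\<close>,
  where local convexity supplies a convex open subset.\<close>

lemma open_bump:
  fixes U :: "'a::locally_convex_tvs set"
  assumes "open U" "x \<in> U"
  obtains g :: "'a \<Rightarrow> real"
  where "continuous_on UNIV g" "\<And>y. g y \<in> {0..1}" "g x > 0" "\<And>y. y \<notin> U \<Longrightarrow> g y = 0"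
proof -
  have "open ((\<lambda>y. x + y) -` U)"
    using assms by (intro open_vimage continuous_intros)
  with assms convex_nhds_zero[of "(\<lambda>y. x + y) -` U"] obtain V
    where V: "open V" "convex V" "0 \<in> V" "V \<subseteq> (\<lambda>y. x + y) -` U" by auto
  from convex_open_bump[OF V(1-3)] obtain g :: "'a \<Rightarrow> real" where
    g: "continuous_on UNIV g" "\<And>y. g y \<in> {0..1}" "g 0 > 0" "\<And>y. y \<notin> V \<Longrightarrow> g y = 0" by blast
  show ?thesis
  proof (rule that)
    show "continuous_on UNIV (\<lambda>y. g (y - x))"
      by (intro continuous_on_compose2[OF g(1)] continuous_intros) auto
    show "g (y - x) \<in> {0..1}" for y by (rule g)
    show "g (x - x) > 0" using g(3) by simp
    fix y assume "y \<notin> U"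
    with V(4) have "y - x \<notin> V" by force
    then show "g (y - x) = 0" by (rule g)
  qed
qed

text \<open>This is the hereditary Lindelof property: the family need not cover the space. It is
  inherited from the separable metric space through \<open>h\<close>, whose small balls around a
  countable dense set form a countable base.\<close>

lemma souslin_space_countable_subcover:
  fixes \<V> :: "'a::souslin_space set set"
  assumes "\<And>V. V \<in> \<V> \<Longrightarrow> open V"
  obtains \<W> where "countable \<W>" "\<W> \<subseteq> \<V>" "\<Union>\<W> = \<Union>\<V>"
proof -
  obtain m :: "(nat \<Rightarrow> real) metric" and h where
    sep: "separable_space (mtopology_of m)" and
    h: "continuous_map (mtopology_of m) (euclidean :: 'a topology) h" "h ` mspace m = UNIV"
    using souslin by blast
  interpret Metric_space "mspace m" "mdist m" by (rule Metric_space_mspace_mdist)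
  obtain C where C: "countable C" "C \<subseteq> mspace m" "mtopology closure_of C = mspace m"
    using sep by (auto simp: separable_space_def mtopology_of_def)
  \<comment> \<open>The pairs in \<open>I\<close> index the basic balls that fit into the preimage
    of some member of the family; \<open>T\<close> chooses one such member for each.\<close>
  define I where
    "I = {(c, k). c \<in> C \<and> (\<exists>V\<in>\<V>. mball c (inverse (Suc k)) \<subseteq> h -` V)}"
  define T where "T = (\<lambda>(c, k). SOME V. V \<in> \<V> \<and> mball c (inverse (real (Suc k))) \<subseteq> h -` V)"
  have T: "T (c, k) \<in> \<V> \<and> mball c (inverse (Suc k)) \<subseteq> h -` T (c, k)" if "(c, k) \<in> I" for c k
  proof -
    have "\<exists>V. V \<in> \<V> \<and> mball c (inverse (real (Suc k))) \<subseteq> h -` V"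
      using that by (auto simp: I_def)
    from someI_ex[OF this] show ?thesis by (simp add: T_def)
  qed
  show ?thesis
  proof (rule that)
    have "countable (C \<times> (UNIV :: nat set))" using C(1) by simp
    then have "countable I" by (rule countable_subset[rotated]) (auto simp: I_def)
    then show "countable (T ` I)" by simp
    show sub: "T ` I \<subseteq> \<V>" using T by auto
    have "y \<in> \<Union>(T ` I)" if "y \<in> V" "V \<in> \<V>" for y V
    proof -
      obtain z where z: "z \<in> mspace m" "h z = y" using h(2) by (metis UNIV_I imageE)
      have "openin mtopology {w \<in> mspace m. h w \<in> V}"
        using openin_continuous_map_preimage[OF h(1), of V] assms[OF \<open>V \<in> \<V>\<close>]
        by (simp add: mtopology_of_def)
      with z \<open>y \<in> V\<close> have "\<exists>r>0. mball z r \<subseteq> {w \<in> mspace m. h w \<in> V}"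
        by (simp add: openin_mtopology)
      then obtain r where r: "r > 0" "mball z r \<subseteq> h -` V" by (elim exE conjE) auto
      \<comment> \<open>With a radius below \<open>r / 2\<close>, a ball that contains
        \<open>z\<close> lies inside the ball of radius \<open>r\<close> around
        \<open>z\<close>.\<close>
      from reals_Archimedean[of "r / 2"] r(1) obtain k where k: "inverse (real (Suc k)) < r / 2"
        by auto
      have "z \<in> mtopology closure_of C" using z C by simp
      then obtain c where c: "c \<in> C" "c \<in> mball z (inverse (real (Suc k)))"
        unfolding metric_closure_of using z by (auto simp: dest!: spec[of _ "inverse (real (Suc k))"])
      have "mball c (inverse (real (Suc k))) \<subseteq> mball z r"
      proof
        fix w assume w: "w \<in> mball c (inverse (real (Suc k)))"
        with c z have "mdist m z w \<le> mdist m z c + mdist m c w" by (intro triangle) auto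
        with w c z k show "w \<in> mball z r" by auto
      qed
      with r(2) c(1) \<open>V \<in> \<V>\<close> have "(c, k) \<in> I" by (auto simp: I_def)
      moreover have "z \<in> mball c (inverse (real (Suc k)))" using c z by (auto simp: commute)
      ultimately show ?thesis using T[of c k] z(2) by blast
    qed
    with sub show "\<Union>(T ` I) = \<Union>\<V>" by blast
  qed
qed

text \<open>By \<open>open_bump\<close>, \<open>U\<close> is a union of positivity sets of
  continuous functions vanishing off \<open>U\<close>, and by the Lindelof property countably many
  of these suffice. Their scaled and truncated partial sums converge to the indicator.\<close>

lemma indicator_open_LIMSEQ_continuous:
  fixes U :: "'a::{locally_convex_tvs, souslin_space} set"
  assumes "open U"
  obtains u :: "nat \<Rightarrow> 'a \<Rightarrow> real"
  where "\<And>k. continuous_on UNIV (u k)" "\<And>k y. u k y \<in> {0..1}"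
    "\<And>y. (\<lambda>k. u k y) \<longlonglongrightarrow> indicator U y"
proof -
  define \<G> where
    "\<G> = {g :: 'a \<Rightarrow> real. continuous_on UNIV g \<and> (\<forall>y. 0 \<le> g y) \<and> (\<forall>y. y \<notin> U \<longrightarrow> g y = 0)}"
  have op: "open V" if "V \<in> (\<lambda>g. {y. g y > 0}) ` \<G>" for V
    using that by (auto simp: \<G>_def intro!: open_Collect_less continuous_intros)
  from souslin_space_countable_subcover[of "(\<lambda>g. {y. g y > 0}) ` \<G>", OF op]
  obtain \<W> where \<W>: "countable \<W>" "\<W> \<subseteq> (\<lambda>g. {y. g y > 0}) ` \<G>"
    "\<Union>\<W> = (\<Union>g\<in>\<G>. {y. g y > 0})"
    by blast
  \<comment> \<open>Passes from the countably many positivity sets to countably many functions that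
    have them.\<close>
  obtain H where H: "countable H" "H \<subseteq> \<G>" "\<W> = (\<lambda>g. {y. g y > 0}) ` H"
    using countable_subset_image[THEN iffD1, OF conjI, OF \<W>(1,2)] by (elim exE conjE)
  \<comment> \<open>Inserting the zero function keeps the enumerated family nonempty even if
    \<open>H\<close> is empty.\<close>
  have zero: "(\<lambda>_. 0) \<in> \<G>" by (simp add: \<G>_def)
  define G where "G = from_nat_into (insert (\<lambda>_. 0) H)"
  have ran: "range G = insert (\<lambda>_. 0) H"
    unfolding G_def using H by (intro range_from_nat_into) auto
  then have GG: "G k \<in> \<G>" for k using H(2) zero by (metis insert_subset rangeI subsetD)
  \<comment> \<open>The factor \<open>k\<close> pushes a positive sum above \<open>1\<close>, so at
    each point of \<open>U\<close> the truncated value is eventually exactly \<open>1\<close>; off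
    \<open>U\<close> every summand is \<open>0\<close>.\<close>
  define u where "u k y = min 1 (real k * (\<Sum>j<k. G j y))" for k y
  have pos: "0 \<le> G k y" for k y using GG[of k] by (simp add: \<G>_def)
  show ?thesis
  proof (rule that)
    show "continuous_on UNIV (u k)" for k
      unfolding u_def using GG by (intro continuous_intros) (auto simp: \<G>_def)
    show "u k y \<in> {0..1}" for k y
      using pos by (auto simp: u_def intro!: sum_nonneg mult_nonneg_nonneg)
    show "(\<lambda>k. u k y) \<longlonglongrightarrow> indicator U y" for y
    proof (cases "y \<in> U")
      case False
      then have "G k y = 0" for k using GG[of k] by (simp add: \<G>_def)
      then show ?thesis using False by (simp add: u_def)
    next
      case True
      from open_bump[OF assms True] obtain g :: "'a \<Rightarrow> real"
        where "continuous_on UNIV g" "\<And>y. g y \<in> {0..1}" "g y > 0" "\<And>y. y \<notin> U \<Longrightarrow> g y = 0"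
        by blast
      then have "y \<in> \<Union>\<W>" unfolding \<W>(3) by (auto simp: \<G>_def)
      then obtain g' where "g' \<in> H" "g' y > 0" using H(3) by auto
      then obtain j where j: "G j y > 0" using ran by (metis imageE insertCI)
      obtain K where K: "1 / G j y \<le> real K" using real_arch_simple by blast
      have "u k y = 1" if "k \<ge> max (Suc j) K" for k
      proof -
        have "1 \<le> real K * G j y" using K j by (simp add: field_simps)
        also have "\<dots> \<le> real k * (\<Sum>j<k. G j y)"
          using that pos by (intro mult_mono member_le_sum) auto
        finally show ?thesis by (simp add: u_def)
      qed
      then have "\<forall>\<^sub>F k in sequentially. u k y = 1" unfolding eventually_sequentially by blast
      then show ?thesis using True by (simp add: tendsto_eventually)
    qed
  qed
qed

text \<open>Open sets form an intersection-stable generator of the Borel sets, and on an open set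
  both measures are limits of integrals of the same continuous functions, by dominated convergence
  with the constant bound \<open>1\<close>.\<close>

lemma finite_borel_measure_eqI_continuous:
  fixes M N :: "'a::{locally_convex_tvs, souslin_space} measure"
  assumes "finite_measure M" "finite_measure N"
    and [measurable_cong]: "sets M = sets borel" "sets N = sets borel"
    and eq: "\<And>g. continuous_on UNIV g \<Longrightarrow> (\<And>y. g y \<in> {0..1::real}) \<Longrightarrow>
      (\<integral>\<^sup>+ y. ennreal (g y) \<partial>M) = (\<integral>\<^sup>+ y. ennreal (g y) \<partial>N)"
  shows "M = N"
proof (rule measure_eqI_generator_eq[where E = "{U. open U}" and \<Omega> = UNIV and A = "\<lambda>_. UNIV"])
  interpret M: finite_measure M by fact
  interpret N: finite_measure N by fact
  fix U :: "'a set" assume "U \<in> {U. open U}"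
  then have U: "open U" by simp
  from indicator_open_LIMSEQ_continuous[OF U] obtain u :: "nat \<Rightarrow> 'a \<Rightarrow> real" where
    u: "\<And>k. continuous_on UNIV (u k)" "\<And>k y. u k y \<in> {0..1}"
      "\<And>y. (\<lambda>k. u k y) \<longlonglongrightarrow> indicator U y" by blast
  have [measurable]: "u k \<in> borel_measurable borel" for k
    by (rule borel_measurable_continuous_onI[OF u(1)])
  have lim: "(\<lambda>k. \<integral>\<^sup>+ y. ennreal (u k y) \<partial>Q) \<longlonglongrightarrow> emeasure Q U"
    if "finite_measure Q" and [measurable_cong]: "sets Q = sets borel" for Q
  proof -
    interpret Q: finite_measure Q by fact
    have [measurable]: "U \<in> sets Q" using U that by simp
    have "(\<lambda>k. \<integral>\<^sup>+ y. ennreal (u k y) \<partial>Q) \<longlonglongrightarrow> (\<integral>\<^sup>+ y. ennreal (indicator U y) \<partial>Q)"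
    proof (rule nn_integral_dominated_convergence[where w = "\<lambda>_. 1"])
      show "AE y in Q. ennreal (u j y) \<le> 1" for j using u(2)[of j] by simp
      show "(\<integral>\<^sup>+ y. 1 \<partial>Q) < \<infinity>" by (simp add: less_top[symmetric])
      show "AE y in Q. (\<lambda>k. ennreal (u k y)) \<longlonglongrightarrow> ennreal (indicator U y)"
        using u(3) by (intro AE_I2 tendsto_ennrealI)
    qed measurable
    then show ?thesis by (simp add: ennreal_indicator)
  qed
  show "emeasure M U = emeasure N U"
    using LIMSEQ_unique[OF lim[of M]] lim[of N] assms(1-4) eq[OF u(1,2)] by simp
next
  show "Int_stable {U :: 'a set. open U}" by (auto simp: Int_stable_def)
  show "sets M = sigma_sets UNIV {U. open U}" "sets N = sigma_sets UNIV {U. open U}"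
    using assms(3,4) by (simp_all add: borel_def)
  show "emeasure M UNIV \<noteq> \<infinity>" using finite_measure.emeasure_finite[OF assms(1)] by simp
qed auto

subsection \<open>Shifts of finitely many independent variables\<close>

text \<open>A product measure is determined by its values on boxes, where the integrand splits into
  one factor per coordinate.\<close>

lemma density_PiM:
  fixes M :: "'i \<Rightarrow> 'a measure" and r :: "'i \<Rightarrow> 'a \<Rightarrow> ennreal"
  assumes "finite I" and "\<And>i. prob_space (M i)" and "\<And>i. prob_space (density (M i) (r i))"
    and [measurable]: "\<And>i. r i \<in> borel_measurable (M i)"
  shows "density (PiM I M) (\<lambda>x. \<Prod>i\<in>I. r i (x i)) = PiM I (\<lambda>i. density (M i) (r i))"
proof (rule product_sigma_finite.PiM_eqI)
  interpret M: product_prob_space M by (rule product_prob_spaceI) fact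
  interpret N: product_prob_space "\<lambda>i. density (M i) (r i)" by (rule product_prob_spaceI) fact
  show "product_sigma_finite (\<lambda>i. density (M i) (r i))" by unfold_locales
  show "finite I" by fact
  show "sets (density (PiM I M) (\<lambda>x. \<Prod>i\<in>I. r i (x i))) = sets (PiM I (\<lambda>i. density (M i) (r i)))"
    by (simp cong: sets_PiM_cong)
  fix A assume "\<And>i. i \<in> I \<Longrightarrow> A i \<in> sets (density (M i) (r i))"
  then have A[measurable]: "i \<in> I \<Longrightarrow> A i \<in> sets (M i)" for i by simp
  have "emeasure (density (PiM I M) (\<lambda>x. \<Prod>i\<in>I. r i (x i))) (Pi\<^sub>E I A)
      = (\<integral>\<^sup>+ x. (\<Prod>i\<in>I. r i (x i)) * indicator (Pi\<^sub>E I A) x \<partial>PiM I M)"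
    using assms(1) A by (intro emeasure_density sets_PiM_I_finite) measurable
  also have "\<dots> = (\<integral>\<^sup>+ x. (\<Prod>i\<in>I. r i (x i) * indicator (A i) (x i)) \<partial>PiM I M)"
  proof (rule nn_integral_cong)
    fix x assume x: "x \<in> space (PiM I M)"
    \<comment> \<open>Points of the product space are extensional, so leaving the box is always
      witnessed by some coordinate in \<open>I\<close>.\<close>
    have "indicator (Pi\<^sub>E I A) x = (\<Prod>i\<in>I. indicator (A i) (x i) :: ennreal)"
    proof (cases "x \<in> Pi\<^sub>E I A")
      case True
      then show ?thesis by (auto simp: PiE_iff)
    next
      case False
      with x obtain i where "i \<in> I" "x i \<notin> A i" by (auto simp: space_PiM PiE_iff)
      then have "(\<Prod>i\<in>I. indicator (A i) (x i) :: ennreal) = 0"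
        using assms(1) by (intro prod_zero) (auto intro!: bexI[of _ i])
      with False show ?thesis by simp
    qed
    then show "(\<Prod>i\<in>I. r i (x i)) * indicator (Pi\<^sub>E I A) x
        = (\<Prod>i\<in>I. r i (x i) * indicator (A i) (x i))" by (simp add: prod.distrib)
  qed
  also have "\<dots> = (\<Prod>i\<in>I. \<integral>\<^sup>+ x. r i x * indicator (A i) x \<partial>M i)"
    using assms(1) A
    by (intro M.product_nn_integral_prod borel_measurable_times_ennreal borel_measurable_indicator) auto
  also have "\<dots> = (\<Prod>i\<in>I. emeasure (density (M i) (r i)) (A i))"
    using A by (intro prod.cong refl emeasure_density[symmetric]) auto
  finally show "emeasure (density (PiM I M) (\<lambda>x. \<Prod>i\<in>I. r i (x i))) (Pi\<^sub>E I A)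
      = (\<Prod>i\<in>I. emeasure (density (M i) (r i)) (A i))" .
qed

text \<open>Translation invariance of Lebesgue measure moves the shift into \<open>\<rho>\<close>.
  Dividing by \<open>\<rho> t\<close> is legitimate because it is positive almost everywhere; at its
  zeros the quotient is \<open>0\<close> by convention.\<close>

lemma distr_shift_density_lborel:
  fixes \<rho> :: "real \<Rightarrow> real"
  assumes [measurable]: "\<rho> \<in> borel_measurable borel" and "\<And>t. 0 \<le> \<rho> t"
    and "AE t in lborel. 0 < \<rho> t"
  shows "distr (density lborel \<rho>) borel (\<lambda>t. t + b)
    = density (density lborel \<rho>) (\<lambda>t. ennreal (\<rho> (t - b) / \<rho> t))"
proof (rule measure_eqI)
  fix A assume "A \<in> sets (distr (density lborel \<rho>) borel (\<lambda>t. t + b))"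
  then have [measurable]: "A \<in> sets borel" by simp
  have "emeasure (distr (density lborel \<rho>) borel (\<lambda>t. t + b)) A
      = (\<integral>\<^sup>+ t. indicator A t \<partial>distr (density lborel \<rho>) borel (\<lambda>t. t + b))" by simp
  also have "\<dots> = (\<integral>\<^sup>+ t. ennreal (\<rho> t) * indicator A (t + b) \<partial>lborel)"
    by (subst nn_integral_distr) (auto simp: nn_integral_density)
  also have "\<dots> = (\<integral>\<^sup>+ t. ennreal (\<rho> (t - b)) * indicator A t \<partial>lborel)"
    by (subst (2) nn_integral_real_affine[where c = 1 and t = b]) (auto simp: add.commute)
  also have "\<dots> = (\<integral>\<^sup>+ t. ennreal (\<rho> t) * (ennreal (\<rho> (t - b) / \<rho> t) * indicator A t) \<partial>lborel)"
  proof (rule nn_integral_cong_AE)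
    show "AE t in lborel. ennreal (\<rho> (t - b)) * indicator A t
        = ennreal (\<rho> t) * (ennreal (\<rho> (t - b) / \<rho> t) * indicator A t)"
      using assms(3)
    proof eventually_elim
      case (elim t)
      then have "ennreal (\<rho> t) * ennreal (\<rho> (t - b) / \<rho> t) = ennreal (\<rho> (t - b))"
        using assms(2) by (subst ennreal_mult[symmetric]) auto
      then show ?case by (simp add: mult.assoc[symmetric])
    qed
  qed
  also have "\<dots> = emeasure (density (density lborel \<rho>) (\<lambda>t. ennreal (\<rho> (t - b) / \<rho> t))) A"
    by (subst emeasure_density) (auto simp: nn_integral_density)
  finally show "emeasure (distr (density lborel \<rho>) borel (\<lambda>t. t + b)) A
      = emeasure (density (density lborel \<rho>) (\<lambda>t. ennreal (\<rho> (t - b) / \<rho> t))) A" .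
qed simp

text \<open>Independence survives the shifts, so the joint laws before and after are both product
  measures and the one-dimensional densities multiply.\<close>

lemma (in prob_space) nn_integral_indep_vars_shift:
  fixes X :: "'i \<Rightarrow> 'a \<Rightarrow> real" and r :: "'i \<Rightarrow> real \<Rightarrow> ennreal"
  assumes indep: "indep_vars (\<lambda>_. borel) X I" and I: "finite I"
    and X[measurable]: "\<And>i. X i \<in> borel_measurable M"
    and [measurable]: "\<And>i. r i \<in> borel_measurable borel"
    and shift: "\<And>i. distr M borel (\<lambda>\<omega>. X i \<omega> + b i) = density (distr M borel (X i)) (r i)"
    and F[measurable]: "F \<in> borel_measurable (PiM I (\<lambda>_. borel))"
  shows "(\<integral>\<^sup>+ \<omega>. F (\<lambda>i\<in>I. X i \<omega> + b i) \<partial>M)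
    = (\<integral>\<^sup>+ \<omega>. (\<Prod>i\<in>I. r i (X i \<omega>)) * F (\<lambda>i\<in>I. X i \<omega>) \<partial>M)"
\<comment> \<open>The description of independence by product measures is used for nonempty
  \<open>I\<close>. For empty \<open>I\<close> the product of densities is \<open>1\<close> and both
  sides coincide.\<close>
proof (cases "I = {}")
  case False
  have indep': "indep_vars (\<lambda>_. borel) (\<lambda>i \<omega>. X i \<omega> + b i) I"
    by (rule indep_vars_compose2[OF indep]) simp
  have m: "(\<lambda>\<omega>. \<lambda>i\<in>I. X i \<omega>) \<in> measurable M (PiM I (\<lambda>_. borel))"
    "(\<lambda>\<omega>. \<lambda>i\<in>I. X i \<omega> + b i) \<in> measurable M (PiM I (\<lambda>_. borel))" by measurable
  have "(\<integral>\<^sup>+ \<omega>. F (\<lambda>i\<in>I. X i \<omega> + b i) \<partial>M)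
      = (\<integral>\<^sup>+ x. F x \<partial>distr M (PiM I (\<lambda>_. borel)) (\<lambda>\<omega>. \<lambda>i\<in>I. X i \<omega> + b i))"
    by (rule nn_integral_distr[symmetric, OF m(2)]) simp
  also have "distr M (PiM I (\<lambda>_. borel)) (\<lambda>\<omega>. \<lambda>i\<in>I. X i \<omega> + b i)
      = PiM I (\<lambda>i. density (distr M borel (X i)) (r i))"
    using indep_vars_iff_distr_eq_PiM'[of I "\<lambda>i \<omega>. X i \<omega> + b i" "\<lambda>_. borel"] False indep'
    by (simp add: shift)
  also have "\<dots> = density (PiM I (\<lambda>i. distr M borel (X i))) (\<lambda>x. \<Prod>i\<in>I. r i (x i))"
    by (intro density_PiM[symmetric] I)
       (auto simp: shift[symmetric] intro!: prob_space_distr)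
  also have "PiM I (\<lambda>i. distr M borel (X i)) = distr M (PiM I (\<lambda>_. borel)) (\<lambda>\<omega>. \<lambda>i\<in>I. X i \<omega>)"
    using indep_vars_iff_distr_eq_PiM'[of I X "\<lambda>_. borel"] False indep by simp
  also have "(\<integral>\<^sup>+ x. F x \<partial>density \<dots> (\<lambda>x. \<Prod>i\<in>I. r i (x i)))
      = (\<integral>\<^sup>+ \<omega>. (\<Prod>i\<in>I. r i (X i \<omega>)) * F (\<lambda>i\<in>I. X i \<omega>) \<partial>M)"
  proof -
    have "(\<lambda>x. \<Prod>i\<in>I. r i (x i)) \<in> borel_measurable (PiM I (\<lambda>_. borel))" by measurable
    then show ?thesis
      by (subst nn_integral_density) (auto simp: nn_integral_distr[OF m(1)] cong: prod.cong)
  qed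
  finally show ?thesis .
qed (simp add: restrict_def)

subsection \<open>Truncated shifts of a random series\<close>

lemma coeffs_of_eqI:
  assumes "series_basis f" and "(\<lambda>i. c i *\<^sub>R f i) sums y"
  shows "coeffs_of f y = c"
  unfolding coeffs_of_def
proof (rule the1_equality)
  show "\<exists>!c. (\<lambda>i. c i *\<^sub>R f i) sums y" using assms(1) by (simp add: series_basis_def)
qed fact

text \<open>In a general topological vector space a sum of Borel maps need not be Borel.
  Measurability is therefore drawn from continuity on the space of coefficient sequences, whose
  Borel sets form the product sigma-algebra.\<close>

lemma borel_measurable_PiM_partial_sum:
  fixes f :: "nat \<Rightarrow> 'a::real_tvs" and g :: "'a \<Rightarrow> real"
  assumes "continuous_on UNIV g" and "{..<m} \<subseteq> I"
  shows "(\<lambda>c. g ((\<Sum>i<m. c i *\<^sub>R f i) + v)) \<in> borel_measurable (PiM I (\<lambda>_. borel))"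
proof -
  have "continuous_on UNIV (\<lambda>c. g ((\<Sum>i<m. c i *\<^sub>R f i) + v))"
    by (intro continuous_on_compose2[OF assms(1)] continuous_intros continuous_on_scaleR_tvs
        continuous_on_product_coordinates) auto
  then have "(\<lambda>c. g ((\<Sum>i<m. c i *\<^sub>R f i) + v)) \<in> borel_measurable borel"
    by (rule borel_measurable_continuous_onI)
  then have *: "(\<lambda>c. g ((\<Sum>i<m. c i *\<^sub>R f i) + v)) \<in> borel_measurable (PiM UNIV (\<lambda>_. borel))"
    by (simp cong: measurable_cong_sets add: sets_PiM_equal_borel)
  \<comment> \<open>Padding with zeros carries families indexed by \<open>I\<close> to full
    sequences and leaves the partial sum unchanged.\<close>
  have "(\<lambda>c. if i < m then c i else 0) \<in> borel_measurable (PiM I (\<lambda>_. borel :: real measure))" for i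
    using assms(2) by (cases "i < m") (auto intro!: measurable_component_singleton)
  then have tr: "(\<lambda>c i. if i < m then c i else 0)
      \<in> measurable (PiM I (\<lambda>_. borel)) (PiM UNIV (\<lambda>_. borel :: real measure))"
    by (intro measurable_PiM_single') (auto simp: space_PiM)
  moreover have "(\<Sum>i<m. (if i < m then c i else 0) *\<^sub>R f i) = (\<Sum>i<m. c i *\<^sub>R f i)" for c
    by (intro sum.cong) auto
  ultimately show ?thesis using measurable_compose[OF tr *] by simp
qed

text \<open>For every \<open>m \<ge> n\<close> the shift of the \<open>m\<close>-th partial sum has
  the same density factor \<open>p\<close>, because only the first \<open>n\<close> coordinates
  move. Hence \<open>m\<close> can tend to infinity with \<open>p\<close> fixed, and the resulting
  identity for continuous functions determines the law.\<close>

lemma (in prob_space) distr_truncated_shift: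
  fixes f :: "nat \<Rightarrow> 'g::{locally_convex_tvs, souslin_space}" and \<rho> :: "nat \<Rightarrow> real \<Rightarrow> real"
  assumes basis: "series_basis f"
    and coeffs[measurable]: "\<And>i. (\<lambda>y. coeffs_of f y i) \<in> borel_measurable borel"
    and \<epsilon>[measurable]: "\<epsilon> \<in> borel_measurable M"
    and sums: "AE \<omega> in M. (\<lambda>i. X i \<omega> *\<^sub>R f i) sums \<epsilon> \<omega>"
    and indep: "indep_vars (\<lambda>_. borel) X UNIV"
    and nonneg: "\<And>i t. 0 \<le> \<rho> i t"
    and dens: "\<And>i. distributed M lborel (X i) (\<lambda>t. ennreal (\<rho> i t))"
    and pos: "\<And>i. AE t in lborel. 0 < \<rho> i t"
  shows "distr M borel (\<lambda>\<omega>. \<epsilon> \<omega> + (\<Sum>i<n. b i *\<^sub>R f i)) = density (distr M borel \<epsilon>)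
    (\<lambda>y. ennreal ((\<Prod>i<n. \<rho> i (coeffs_of f y i - b i)) / (\<Prod>i<n. \<rho> i (coeffs_of f y i))))"
proof -
  have [measurable]: "\<rho> i \<in> borel_measurable borel" for i
    using distributed_real_measurable[OF nonneg dens, of i] by simp
  have X[measurable]: "X i \<in> borel_measurable M" for i
    using distributed_measurable[OF dens, of i] by simp
  define v where "v = (\<Sum>i<n. b i *\<^sub>R f i)"
  define q where
    "q y = (\<Prod>i<n. \<rho> i (coeffs_of f y i - b i)) / (\<Prod>i<n. \<rho> i (coeffs_of f y i))" for y
  have [measurable]: "q \<in> borel_measurable borel" unfolding q_def by measurable
  \<comment> \<open>Beyond \<open>n\<close> the shift is \<open>0\<close> and the density
    \<open>1\<close>, so that one change of variables covers all \<open>m\<close> coordinates at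
    once.\<close>
  define b' where "b' i = (if i < n then b i else 0)" for i
  define r where "r i t = (if i < n then ennreal (\<rho> i (t - b i) / \<rho> i t) else 1)" for i t
  have [measurable]: "r i \<in> borel_measurable borel" for i unfolding r_def by measurable
  have shift: "distr M borel (\<lambda>\<omega>. X i \<omega> + b' i) = density (distr M borel (X i)) (r i)" for i
  proof (cases "i < n")
    case True
    \<comment> \<open>The hypothesis \<open>dens\<close> concerns the law taken on
      \<open>lborel\<close>; its sets are those of \<open>borel\<close>, so the law is the
      same.\<close>
    have dX: "distr M borel (X i) = density lborel (\<rho> i)"
      using distributed_distr_eq_density[OF dens, of i]
        distr_cong[OF refl sets_lborel[symmetric] refl, of M "X i"] by simp
    have ri: "r i = (\<lambda>t. ennreal (\<rho> i (t - b i) / \<rho> i t))"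
      using True by (simp add: r_def fun_eq_iff)
    have "distr M borel (\<lambda>\<omega>. X i \<omega> + b' i) = distr (distr M borel (X i)) borel (\<lambda>t. t + b i)"
      using True by (subst distr_distr) (auto simp: comp_def b'_def)
    also have "\<dots> = density (distr M borel (X i)) (r i)"
      unfolding dX ri by (rule distr_shift_density_lborel) (use nonneg pos in auto)
    finally show ?thesis .
  next
    case False
    then have "r i = (\<lambda>_. 1)" by (simp add: r_def fun_eq_iff)
    with False show ?thesis by (simp add: b'_def density_1)
  qed
  define p where "p \<omega> = (\<Prod>i<n. r i (X i \<omega>))" for \<omega>
  have [measurable]: "p \<in> borel_measurable M" unfolding p_def by measurable
  have p_prod: "(\<Prod>i<m. r i (X i \<omega>)) = p \<omega>" if "n \<le> m" for m \<omega>
    unfolding p_def using that by (intro prod.mono_neutral_right) (auto simp: r_def)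
  \<comment> \<open>Uniqueness of coefficients identifies those of
    \<open>\<epsilon> \<omega>\<close> with the \<open>X i \<omega>\<close>, which turns the factor
    on \<open>M\<close> into a function of \<open>\<epsilon>\<close>.\<close>
  have p_q: "AE \<omega> in M. p \<omega> = ennreal (q (\<epsilon> \<omega>))"
    using sums
  proof eventually_elim
    case (elim \<omega>)
    then have "coeffs_of f (\<epsilon> \<omega>) = (\<lambda>i. X i \<omega>)" by (rule coeffs_of_eqI[OF basis])
    then show ?case
      using nonneg by (simp add: p_def q_def r_def prod_dividef[symmetric] prod_ennreal)
  qed
  have finite_dim: "(\<integral>\<^sup>+ \<omega>. ennreal (g ((\<Sum>i<m. X i \<omega> *\<^sub>R f i) + v)) \<partial>M)
      = (\<integral>\<^sup>+ \<omega>. p \<omega> * ennreal (g (\<Sum>i<m. X i \<omega> *\<^sub>R f i)) \<partial>M)"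
    if g: "continuous_on UNIV g" and m: "n \<le> m" for g m
  proof -
    have v: "v = (\<Sum>i<m. b' i *\<^sub>R f i)"
      unfolding v_def b'_def using m by (intro sum.mono_neutral_cong_left) auto
    have [measurable]: "(\<lambda>c. g (\<Sum>i<m. c i *\<^sub>R f i)) \<in> borel_measurable (PiM {..<m} (\<lambda>_. borel))"
      using borel_measurable_PiM_partial_sum[OF g, of m "{..<m}" f 0] by simp
    have ind: "indep_vars (\<lambda>_. borel) X {..<m}"
      by (rule indep_vars_subset[OF indep]) auto
    have restr: "(\<Sum>i<m. restrict h {..<m} i *\<^sub>R f i) = (\<Sum>i<m. h i *\<^sub>R f i)" for h
      by (intro sum.cong) auto
    have "(\<lambda>c. ennreal (g (\<Sum>i<m. c i *\<^sub>R f i))) \<in> borel_measurable (PiM {..<m} (\<lambda>_. borel))"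
      by measurable
    from nn_integral_indep_vars_shift[OF ind finite_lessThan X _ shift this]
    show ?thesis
      by (simp add: p_prod[OF m] restr v scaleR_add_left sum.distrib del: restrict_apply)
  qed
  \<comment> \<open>The constant function \<open>1\<close> in the change of variables shows that
    \<open>p\<close> has mass \<open>1\<close>, so it can serve as an integrable majorant
    below.\<close>
  have p_int: "(\<integral>\<^sup>+ \<omega>. p \<omega> \<partial>M) = 1"
  proof -
    have "(\<integral>\<^sup>+ \<omega>. ennreal 1 \<partial>M) = (\<integral>\<^sup>+ \<omega>. p \<omega> * ennreal 1 \<partial>M)"
      by (rule finite_dim[of "\<lambda>_. 1" n]) simp_all
    then show ?thesis by (simp add: emeasure_space_1)
  qed
  have key: "(\<integral>\<^sup>+ \<omega>. ennreal (g (\<epsilon> \<omega> + v)) \<partial>M) = (\<integral>\<^sup>+ \<omega>. p \<omega> * ennreal (g (\<epsilon> \<omega>)) \<partial>M)"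
    if g: "continuous_on UNIV g" "\<And>y. g y \<in> {0..1}" for g
  proof -
    have g1: "ennreal (g y) \<le> 1" for y using g(2)[of y] by simp
    have [measurable]: "g \<in> borel_measurable borel"
      by (rule borel_measurable_continuous_onI[OF g(1)])
    have gv[measurable]: "(\<lambda>y. g (y + v)) \<in> borel_measurable borel"
      by (intro borel_measurable_continuous_onI continuous_on_compose2[OF g(1)] continuous_intros) auto
    have "(\<lambda>\<omega>. \<lambda>i\<in>UNIV. X i \<omega>) \<in> measurable M (PiM UNIV (\<lambda>_. borel))" by measurable
    from measurable_compose[OF this borel_measurable_PiM_partial_sum[OF g(1), of _ UNIV f]]
    have S[measurable]: "(\<lambda>\<omega>. g ((\<Sum>i<m. X i \<omega> *\<^sub>R f i) + w)) \<in> borel_measurable M" for m w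
      by simp
    have [measurable]: "(\<lambda>\<omega>. g (\<Sum>i<m. X i \<omega> *\<^sub>R f i)) \<in> borel_measurable M" for m
      using S[of m 0] by simp
    have [measurable]: "(\<lambda>\<omega>. g (\<epsilon> \<omega> + v)) \<in> borel_measurable M"
      by (rule measurable_compose[OF \<epsilon> gv])
    have g_lim: "(\<lambda>m. ennreal (g ((\<Sum>i<m. X i \<omega> *\<^sub>R f i) + w))) \<longlonglongrightarrow> ennreal (g (\<epsilon> \<omega> + w))"
      if "(\<lambda>i. X i \<omega> *\<^sub>R f i) sums \<epsilon> \<omega>" for \<omega> w
      using that unfolding sums_def
      by (intro tendsto_ennrealI continuous_on_tendsto_compose[OF g(1)] tendsto_add tendsto_const) auto
    have lim1: "(\<lambda>m. \<integral>\<^sup>+ \<omega>. ennreal (g ((\<Sum>i<m. X i \<omega> *\<^sub>R f i) + v)) \<partial>M)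
        \<longlonglongrightarrow> (\<integral>\<^sup>+ \<omega>. ennreal (g (\<epsilon> \<omega> + v)) \<partial>M)"
    proof (rule nn_integral_dominated_convergence[where w = "\<lambda>_. 1"])
      show "AE \<omega> in M. (\<lambda>m. ennreal (g ((\<Sum>i<m. X i \<omega> *\<^sub>R f i) + v))) \<longlonglongrightarrow> ennreal (g (\<epsilon> \<omega> + v))"
        using sums by eventually_elim (rule g_lim)
    qed (use g1 in \<open>auto simp: emeasure_space_1\<close>)
    have lim2: "(\<lambda>m. \<integral>\<^sup>+ \<omega>. p \<omega> * ennreal (g (\<Sum>i<m. X i \<omega> *\<^sub>R f i)) \<partial>M)
        \<longlonglongrightarrow> (\<integral>\<^sup>+ \<omega>. p \<omega> * ennreal (g (\<epsilon> \<omega>)) \<partial>M)"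
    proof (rule nn_integral_dominated_convergence[where w = p])
      \<comment> \<open>In \<open>ennreal\<close> only multiplication by a finite constant is
        continuous at \<open>0\<close>.\<close>
      have "AE \<omega> in M. p \<omega> \<noteq> \<infinity>"
        using p_q by eventually_elim simp
      with sums show "AE \<omega> in M. (\<lambda>m. p \<omega> * ennreal (g (\<Sum>i<m. X i \<omega> *\<^sub>R f i)))
          \<longlonglongrightarrow> p \<omega> * ennreal (g (\<epsilon> \<omega>))"
      proof eventually_elim
        case (elim \<omega>)
        then show ?case using g_lim[of \<omega> 0] by (intro ennreal_tendsto_cmult) (auto simp: less_top)
      qed
      show "AE \<omega> in M. p \<omega> * ennreal (g (\<Sum>i<m. X i \<omega> *\<^sub>R f i)) \<le> p \<omega>" for m
        using mult_left_mono[OF g1] by (intro AE_I2) fastforce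
    qed (auto simp: p_int)
    have "\<forall>\<^sub>F m in sequentially. (\<integral>\<^sup>+ \<omega>. ennreal (g ((\<Sum>i<m. X i \<omega> *\<^sub>R f i) + v)) \<partial>M)
        = (\<integral>\<^sup>+ \<omega>. p \<omega> * ennreal (g (\<Sum>i<m. X i \<omega> *\<^sub>R f i)) \<partial>M)"
      using finite_dim[OF g(1)] by (auto simp: eventually_sequentially)
    from Lim_transform_eventually[OF lim1 this] lim2 show ?thesis by (rule LIMSEQ_unique)
  qed
  have [measurable]: "(\<lambda>\<omega>. \<epsilon> \<omega> + v) \<in> borel_measurable M"
    by (rule measurable_compose[OF \<epsilon>], rule borel_measurable_continuous_onI)
       (intro continuous_intros)
  have q_eq: "(\<integral>\<^sup>+ y. h y \<partial>density (distr M borel \<epsilon>) (\<lambda>y. ennreal (q y))) = (\<integral>\<^sup>+ \<omega>. p \<omega> * h (\<epsilon> \<omega>) \<partial>M)"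
    if [measurable]: "h \<in> borel_measurable borel" for h
    using p_q by (subst nn_integral_density) (auto simp: nn_integral_distr intro!: nn_integral_cong_AE)
  have "distr M borel (\<lambda>\<omega>. \<epsilon> \<omega> + v) = density (distr M borel \<epsilon>) (\<lambda>y. ennreal (q y))"
  proof (rule finite_borel_measure_eqI_continuous)
    show "finite_measure (distr M borel (\<lambda>\<omega>. \<epsilon> \<omega> + v))"
      by (intro finite_measure_distr) measurable
    show "finite_measure (density (distr M borel \<epsilon>) (\<lambda>y. ennreal (q y)))"
      using q_eq[of "\<lambda>_. 1"] p_int by (intro finite_measureI) simp
    fix g :: "'g \<Rightarrow> real" assume g: "continuous_on UNIV g" "\<And>y. g y \<in> {0..1}"
    have [measurable]: "g \<in> borel_measurable borel"
      by (rule borel_measurable_continuous_onI[OF g(1)])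
    show "(\<integral>\<^sup>+ y. ennreal (g y) \<partial>distr M borel (\<lambda>\<omega>. \<epsilon> \<omega> + v))
        = (\<integral>\<^sup>+ y. ennreal (g y) \<partial>density (distr M borel \<epsilon>) (\<lambda>y. ennreal (q y)))"
      by (simp add: q_eq nn_integral_distr key[OF g])
  qed simp_all
  then show ?thesis by (simp add: v_def q_def)
qed

subsection \<open>Passage to the limit\<close>

lemma nn_integral_le_liminf_AE:
  fixes u :: "nat \<Rightarrow> 'a \<Rightarrow> ennreal"
  assumes "\<And>n. u n \<in> borel_measurable M" and "AE y in M. (\<lambda>n. u n y) \<longlonglongrightarrow> v y"
    and "(\<lambda>n. \<integral>\<^sup>+ y. u n y \<partial>M) \<longlonglongrightarrow> l"
  shows "(\<integral>\<^sup>+ y. v y \<partial>M) \<le> l"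
proof -
  have "(\<integral>\<^sup>+ y. v y \<partial>M) = (\<integral>\<^sup>+ y. liminf (\<lambda>n. u n y) \<partial>M)"
    using assms(2) by (intro nn_integral_cong_AE, eventually_elim) (simp add: lim_imp_Liminf)
  also have "\<dots> \<le> liminf (\<lambda>n. \<integral>\<^sup>+ y. u n y \<partial>M)" by (rule nn_integral_liminf) fact
  also have "\<dots> = l" using assms(3) by (simp add: lim_imp_Liminf)
  finally show ?thesis .
qed

text \<open>Fatou's lemma gives one inequality. For the other, each \<open>q n\<close> is cut at
  height \<open>K\<close>: the bounded part converges by dominated convergence, and the tails are at
  most \<open>\<delta> K\<close> uniformly in \<open>n\<close>, which vanishes as \<open>K\<close>
  grows.\<close>

lemma uniformly_integrable_nn_integral_lim:
  fixes q :: "nat \<Rightarrow> 'a \<Rightarrow> real"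
  assumes "finite_measure M" and ui: "uniformly_integrable M q"
    and nonneg: "\<And>n y. 0 \<le> q n y" and p[measurable]: "p \<in> borel_measurable M"
    and lim: "AE y in M. (\<lambda>n. q n y) \<longlonglongrightarrow> p y"
    and total: "\<And>n. (\<integral>\<^sup>+ y. ennreal (q n y) \<partial>M) = c"
  shows "(\<integral>\<^sup>+ y. ennreal (p y) \<partial>M) = c"
proof (rule antisym)
  interpret finite_measure M by fact
  have q[measurable]: "q n \<in> borel_measurable M" for n
    using ui by (auto simp: uniformly_integrable_def)
  show "(\<integral>\<^sup>+ y. ennreal (p y) \<partial>M) \<le> c"
  proof (rule nn_integral_le_liminf_AE)
    show "AE y in M. (\<lambda>n. ennreal (q n y)) \<longlonglongrightarrow> ennreal (p y)"
      using lim by eventually_elim (rule tendsto_ennrealI)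
    show "(\<lambda>n. \<integral>\<^sup>+ y. ennreal (q n y) \<partial>M) \<longlonglongrightarrow> c" by (simp add: total)
  qed measurable
  define \<delta> where
    "\<delta> K = (SUP n. \<integral>\<^sup>+ y. ennreal \<bar>q n y\<bar> * indicator {y. K < \<bar>q n y\<bar>} y \<partial>M)" for K :: real
  have \<delta>: "(\<delta> \<longlongrightarrow> 0) at_top"
    using ui by (simp add: uniformly_integrable_def \<delta>_def[abs_def])
  have bound: "c \<le> (\<integral>\<^sup>+ y. ennreal (p y) \<partial>M) + \<delta> K" if "K \<ge> 0" for K
  proof -
    have "c \<le> (\<integral>\<^sup>+ y. ennreal (min (q n y) K) \<partial>M) + \<delta> K" for n
    proof -
      have "c = (\<integral>\<^sup>+ y. ennreal (q n y) \<partial>M)" by (simp add: total)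
      \<comment> \<open>Where \<open>q n y\<close> exceeds \<open>K\<close>, its whole value is
        charged to the tail; elsewhere the cut changes nothing.\<close>
      also have "\<dots> \<le> (\<integral>\<^sup>+ y. ennreal (min (q n y) K)
          + ennreal \<bar>q n y\<bar> * indicator {y. K < \<bar>q n y\<bar>} y \<partial>M)"
        using nonneg by (intro nn_integral_mono) (auto simp: indicator_def min_def)
      also have "\<dots> = (\<integral>\<^sup>+ y. ennreal (min (q n y) K) \<partial>M)
          + (\<integral>\<^sup>+ y. ennreal \<bar>q n y\<bar> * indicator {y. K < \<bar>q n y\<bar>} y \<partial>M)"
        by (rule nn_integral_add) measurable
      also have "\<dots> \<le> (\<integral>\<^sup>+ y. ennreal (min (q n y) K) \<partial>M) + \<delta> K"
        unfolding \<delta>_def by (intro add_left_mono SUP_upper) simp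
      finally show ?thesis .
    qed
    moreover have "(\<lambda>n. \<integral>\<^sup>+ y. ennreal (min (q n y) K) \<partial>M)
        \<longlonglongrightarrow> (\<integral>\<^sup>+ y. ennreal (min (p y) K) \<partial>M)"
    proof (rule nn_integral_dominated_convergence[where w = "\<lambda>_. ennreal K"])
      show "AE y in M. (\<lambda>n. ennreal (min (q n y) K)) \<longlonglongrightarrow> ennreal (min (p y) K)"
        using lim by eventually_elim (intro tendsto_ennrealI tendsto_min tendsto_const)
      show "(\<integral>\<^sup>+ y. ennreal K \<partial>M) < \<infinity>"
        by (simp add: ennreal_mult_less_top less_top[symmetric] ennreal_mult_eq_top_iff)
    qed (auto intro!: ennreal_leI)
    then have "(\<lambda>n. (\<integral>\<^sup>+ y. ennreal (min (q n y) K) \<partial>M) + \<delta> K)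
        \<longlonglongrightarrow> (\<integral>\<^sup>+ y. ennreal (min (p y) K) \<partial>M) + \<delta> K"
      by (intro tendsto_add tendsto_const)
    ultimately have "c \<le> (\<integral>\<^sup>+ y. ennreal (min (p y) K) \<partial>M) + \<delta> K"
      by (intro LIMSEQ_le_const) auto
    also have "\<dots> \<le> (\<integral>\<^sup>+ y. ennreal (p y) \<partial>M) + \<delta> K"
      by (intro add_right_mono nn_integral_mono ennreal_leI) simp
    finally show ?thesis .
  qed
  have "((\<lambda>K. (\<integral>\<^sup>+ y. ennreal (p y) \<partial>M) + \<delta> K) \<longlongrightarrow> (\<integral>\<^sup>+ y. ennreal (p y) \<partial>M) + 0) at_top"
    by (intro tendsto_add tendsto_const \<delta>)
  moreover have "\<forall>\<^sub>F K in at_top. c \<le> (\<integral>\<^sup>+ y. ennreal (p y) \<partial>M) + \<delta> K"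
    using eventually_ge_at_top[of "0 :: real"] by eventually_elim (rule bound)
  ultimately have "c \<le> (\<integral>\<^sup>+ y. ennreal (p y) \<partial>M) + 0"
    by (rule tendsto_lowerbound) simp
  then show "c \<le> (\<integral>\<^sup>+ y. ennreal (p y) \<partial>M)" by simp
qed

text \<open>
  Fatou's lemma applied to both \<open>g\<close> and \<open>1 - g\<close>: no mass is lost in the limit, so neither
  inequality can be strict.
\<close>

lemma nn_integral_mult_lim_of_total:
  fixes q :: "nat \<Rightarrow> 'a \<Rightarrow> ennreal" and g :: "'a \<Rightarrow> real"
  assumes [measurable]: "\<And>n. q n \<in> borel_measurable M" "p \<in> borel_measurable M" "g \<in> borel_measurable M"
    and g: "\<And>y. g y \<in> {0..1}"
    and lim: "AE y in M. (\<lambda>n. q n y) \<longlonglongrightarrow> p y"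
    and total: "\<And>n. (\<integral>\<^sup>+ y. q n y \<partial>M) = c" "(\<integral>\<^sup>+ y. p y \<partial>M) = c" and c: "c < \<infinity>"
    and l: "(\<lambda>n. \<integral>\<^sup>+ y. q n y * ennreal (g y) \<partial>M) \<longlonglongrightarrow> l"
  shows "(\<integral>\<^sup>+ y. p y * ennreal (g y) \<partial>M) = l"
proof -
  have split: "(\<integral>\<^sup>+ y. h y * ennreal (g y) \<partial>M) + (\<integral>\<^sup>+ y. h y * ennreal (1 - g y) \<partial>M) = (\<integral>\<^sup>+ y. h y \<partial>M)"
    if [measurable]: "h \<in> borel_measurable M" for h
  proof -
    have "ennreal (g y) + ennreal (1 - g y) = 1" for y
      using g[of y] by (subst ennreal_plus[symmetric]) auto
    then show ?thesis
      by (subst nn_integral_add[symmetric]) (auto simp: distrib_left[symmetric])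
  qed
  have Fatou: "(\<integral>\<^sup>+ y. p y * ennreal (h y) \<partial>M) \<le> l'"
    if [measurable]: "h \<in> borel_measurable M"
      and l': "(\<lambda>n. \<integral>\<^sup>+ y. q n y * ennreal (h y) \<partial>M) \<longlonglongrightarrow> l'" for h l'
  proof (rule nn_integral_le_liminf_AE[OF _ _ l'])
    show "AE y in M. (\<lambda>n. q n y * ennreal (h y)) \<longlonglongrightarrow> p y * ennreal (h y)"
      using lim
    proof eventually_elim
      case (elim y)
      then have "(\<lambda>n. ennreal (h y) * q n y) \<longlonglongrightarrow> ennreal (h y) * p y"
        by (intro ennreal_tendsto_cmult) auto
      then show ?case by (simp add: mult.commute)
    qed
  qed measurable
  have fin: "(\<integral>\<^sup>+ y. q n y * ennreal (g y) \<partial>M) \<le> c" for n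
    using split[of "q n"] by (simp add: total flip: le_iff_add) (metis le_iff_add)
  then have l_le: "l \<le> c"
    using l by (intro LIMSEQ_le_const2) auto
  have le: "(\<integral>\<^sup>+ y. p y * ennreal (g y) \<partial>M) \<le> l" using Fatou[OF _ l] by simp
  \<comment> \<open>Finiteness of the total \<open>c\<close> permits subtraction in
    \<open>ennreal\<close>, so the complementary integrals converge to \<open>c - l\<close>.\<close>
  have "(\<integral>\<^sup>+ y. q n y * ennreal (1 - g y) \<partial>M) = c - (\<integral>\<^sup>+ y. q n y * ennreal (g y) \<partial>M)" for n
    using split[of "q n"] fin[of n] c total
    by (metis ennreal_add_diff_cancel_left assms(1) infinity_ennreal_def neq_top_trans less_top)
  then have "(\<lambda>n. \<integral>\<^sup>+ y. q n y * ennreal (1 - g y) \<partial>M) \<longlonglongrightarrow> c - l"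
    using c l l_le by (auto simp: top_unique intro!: tendsto_diff_ennreal)
  then have "(\<integral>\<^sup>+ y. p y * ennreal (1 - g y) \<partial>M) \<le> c - l" by (intro Fatou) measurable
  then have "c \<le> (\<integral>\<^sup>+ y. p y * ennreal (g y) \<partial>M) + (c - l)"
    using split[of p] total(2) by (metis add_left_mono assms(2))
  \<comment> \<open>Since \<open>l \<le> c\<close>, the left side is \<open>c\<close>; the finite
    term \<open>c - l\<close> is then cancelled.\<close>
  then have "l + (c - l) \<le> (\<integral>\<^sup>+ y. p y * ennreal (g y) \<partial>M) + (c - l)"
    using l_le by (simp add: add_diff_inverse_ennreal)
  then have "l \<le> (\<integral>\<^sup>+ y. p y * ennreal (g y) \<partial>M)"
    using c by (auto simp: ennreal_add_left_cancel_le add.commute)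
  with le show ?thesis by (rule antisym)
qed

section \<open>Radon-Nikodym derivatives of the shifted laws\<close>

lemma has_RN_deriv_density:
  assumes "sigma_finite_measure M" and "p \<in> borel_measurable M"
  shows "has_RN_deriv M (density M (\<lambda>y. ennreal (p y))) p"
proof -
  interpret sigma_finite_measure M by fact
  have "AE y in M. ennreal (p y) = RN_deriv M (density M (\<lambda>y. ennreal (p y))) y"
    using assms(2) by (intro RN_deriv_unique) auto
  then show ?thesis
    unfolding has_RN_deriv_def
    using assms(2) by (auto intro!: absolutely_continuousI_density elim: eventually_mono)
qed

theorem corollary2:
  fixes P :: "'w measure"
    and f :: "nat \<Rightarrow> 'g::{locally_convex_tvs, souslin_space}"
    and \<epsilon> :: "'w \<Rightarrow> 'g"
    and \<epsilon>c :: "nat \<Rightarrow> 'w \<Rightarrow> real"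
    and \<rho> :: "nat \<Rightarrow> real \<Rightarrow> real"
    and L :: "'f::{locally_convex_tvs, souslin_space} \<Rightarrow> 'g"
    and a :: "nat \<Rightarrow> 'f \<Rightarrow> real"
    and x :: 'f
  defines "\<mu> \<equiv> distr P borel \<epsilon>"
    and "\<mu>_shift \<equiv> \<lambda>v. distr P borel (\<lambda>\<omega>. \<epsilon> \<omega> + v)"
  assumes "prob_space P"
    and "series_basis f"
    and "\<And>i. (\<lambda>y. coeffs_of f y i) \<in> borel_measurable borel"
    and "\<epsilon> \<in> borel_measurable P"
    and "AE \<omega> in P. (\<lambda>i. \<epsilon>c i \<omega> *\<^sub>R f i) sums \<epsilon> \<omega>"
    and "prob_space.indep_vars P (\<lambda>_. borel) \<epsilon>c UNIV"
    and "\<And>i t. 0 \<le> \<rho> i t"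
    and "\<And>i. distributed P lborel (\<epsilon>c i) (\<lambda>t. ennreal (\<rho> i t))"
    and "\<And>i. AE t in lborel. 0 < \<rho> i t"
    and "continuous_on UNIV L"
    and "\<And>z. (\<lambda>i. a i z *\<^sub>R f i) sums L z"
    and "uniformly_integrable \<mu>
           (\<lambda>n y. (\<Prod>i<n. \<rho> i (coeffs_of f y i - a i x)) / (\<Prod>i<n. \<rho> i (coeffs_of f y i)))"
    and "AE y in \<mu>. convergent
           (\<lambda>n. (\<Prod>i<n. \<rho> i (coeffs_of f y i - a i x)) / (\<Prod>i<n. \<rho> i (coeffs_of f y i)))"
  shows "(\<forall>n. has_RN_deriv \<mu> (\<mu>_shift (\<Sum>i<n. a i x *\<^sub>R f i))
           (\<lambda>y. (\<Prod>i<n. \<rho> i (coeffs_of f y i - a i x)) / (\<Prod>i<n. \<rho> i (coeffs_of f y i))))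
       \<and> has_RN_deriv \<mu> (\<mu>_shift (L x))
           (\<lambda>y. lim (\<lambda>n. \<Prod>i<n. \<rho> i (coeffs_of f y i - a i x) / \<rho> i (coeffs_of f y i)))"
proof -
  interpret prob_space P by fact
  note \<epsilon>[measurable] = \<open>\<epsilon> \<in> borel_measurable P\<close>
    and [measurable] = assms(5)
  have [measurable]: "\<rho> i \<in> borel_measurable borel" for i
    using distributed_real_measurable[OF assms(9,10), of i] by simp
  have \<mu>: "prob_space \<mu>" unfolding \<mu>_def by (rule prob_space_distr) measurable
  interpret \<mu>: prob_space \<mu> by (rule \<mu>)
  have [measurable_cong]: "sets \<mu> = sets borel" by (simp add: \<mu>_def)
  define q where
    "q n y = (\<Prod>i<n. \<rho> i (coeffs_of f y i - a i x)) / (\<Prod>i<n. \<rho> i (coeffs_of f y i))" for n y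
  \<comment> \<open>Where the sequence diverges, \<open>lim\<close> is unspecified; by hypothesis
    this happens only on a null set of \<open>\<mu>\<close>.\<close>
  define p where "p y = lim (\<lambda>n. q n y)" for y
  have q[measurable]: "q n \<in> borel_measurable borel" for n unfolding q_def by measurable
  have p[measurable]: "p \<in> borel_measurable borel" unfolding p_def by measurable
  have q_nonneg: "0 \<le> q n y" for n y
    unfolding q_def using assms(9) by (intro divide_nonneg_nonneg prod_nonneg) auto
  have trans_cont: "continuous_on UNIV (\<lambda>y. y + v)" for v :: 'g
    by (intro continuous_intros)
  have trans[measurable]: "(\<lambda>\<omega>. \<epsilon> \<omega> + v) \<in> borel_measurable P" for v
    by (rule measurable_compose[OF \<epsilon> borel_measurable_continuous_onI[OF trans_cont]])
  have truncated: "\<mu>_shift (\<Sum>i<n. a i x *\<^sub>R f i) = density \<mu> (\<lambda>y. ennreal (q n y))" for n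
    unfolding \<mu>_def \<mu>_shift_def q_def using assms(4-11) by (rule distr_truncated_shift)
  \<comment> \<open>The truncated shift is read both as a density and as an image measure. The
    second form allows passage to the limit, since there \<open>n\<close> enters only through the
    shift vector.\<close>
  have int_q: "(\<integral>\<^sup>+ y. ennreal (q n y) * h y \<partial>\<mu>) = (\<integral>\<^sup>+ \<omega>. h (\<epsilon> \<omega> + (\<Sum>i<n. a i x *\<^sub>R f i)) \<partial>P)"
    if [measurable]: "h \<in> borel_measurable borel" for n h
  proof -
    have "(\<integral>\<^sup>+ y. ennreal (q n y) * h y \<partial>\<mu>) = (\<integral>\<^sup>+ y. h y \<partial>\<mu>_shift (\<Sum>i<n. a i x *\<^sub>R f i))"
      unfolding truncated by (subst nn_integral_density) auto
    also have "\<dots> = (\<integral>\<^sup>+ \<omega>. h (\<epsilon> \<omega> + (\<Sum>i<n. a i x *\<^sub>R f i)) \<partial>P)"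
      unfolding \<mu>_shift_def by (subst nn_integral_distr) auto
    finally show ?thesis .
  qed
  have total_q: "(\<integral>\<^sup>+ y. ennreal (q n y) \<partial>\<mu>) = 1" for n
    using int_q[of "\<lambda>_. 1" n] by (simp add: emeasure_space_1)
  have q_lim: "AE y in \<mu>. (\<lambda>n. q n y) \<longlonglongrightarrow> p y"
    using assms(15) by eventually_elim (simp add: p_def q_def convergent_LIMSEQ_iff)
  \<comment> \<open>Uniform integrability enters here: it prevents mass from escaping in the
    limit.\<close>
  have total_p: "(\<integral>\<^sup>+ y. ennreal (p y) \<partial>\<mu>) = 1"
  proof (rule uniformly_integrable_nn_integral_lim[OF \<mu>.finite_measure_axioms _ q_nonneg _ q_lim total_q])
    have "q = (\<lambda>n y. (\<Prod>i<n. \<rho> i (coeffs_of f y i - a i x)) / (\<Prod>i<n. \<rho> i (coeffs_of f y i)))"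
      by (intro ext) (rule q_def)
    with assms(14) show "uniformly_integrable \<mu> q" by simp
  qed measurable
  have int_p: "(\<integral>\<^sup>+ y. ennreal (p y) * ennreal (g y) \<partial>\<mu>) = (\<integral>\<^sup>+ \<omega>. ennreal (g (\<epsilon> \<omega> + L x)) \<partial>P)"
    if g: "continuous_on UNIV g" "\<And>y. g y \<in> {0..1}" for g
  proof (rule nn_integral_mult_lim_of_total)
    have [measurable]: "g \<in> borel_measurable borel"
      by (rule borel_measurable_continuous_onI[OF g(1)])
    show "g \<in> borel_measurable \<mu>" by measurable
    have [measurable]: "(\<lambda>\<omega>. g (\<epsilon> \<omega> + v)) \<in> borel_measurable P" for v
      by (rule measurable_compose[OF trans]) simp
    have "(\<lambda>n. \<integral>\<^sup>+ \<omega>. ennreal (g (\<epsilon> \<omega> + (\<Sum>i<n. a i x *\<^sub>R f i))) \<partial>P)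
        \<longlonglongrightarrow> (\<integral>\<^sup>+ \<omega>. ennreal (g (\<epsilon> \<omega> + L x)) \<partial>P)"
    proof (rule nn_integral_dominated_convergence[where w = "\<lambda>_. 1"])
      \<comment> \<open>The convergence holds for every \<open>\<omega>\<close>, because the shift
        vectors \<open>L\<^sub>n x\<close> are deterministic and tend to \<open>L x\<close>.\<close>
      have "(\<lambda>n. ennreal (g (\<epsilon> \<omega> + (\<Sum>i<n. a i x *\<^sub>R f i)))) \<longlonglongrightarrow> ennreal (g (\<epsilon> \<omega> + L x))" for \<omega>
        using assms(13)[of x] unfolding sums_def
        by (intro tendsto_ennrealI continuous_on_tendsto_compose[OF g(1)] tendsto_add tendsto_const) auto
      then show "AE \<omega> in P. (\<lambda>n. ennreal (g (\<epsilon> \<omega> + (\<Sum>i<n. a i x *\<^sub>R f i))))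
          \<longlonglongrightarrow> ennreal (g (\<epsilon> \<omega> + L x))" by simp
      show "AE \<omega> in P. ennreal (g (\<epsilon> \<omega> + (\<Sum>i<n. a i x *\<^sub>R f i))) \<le> 1" for n
        using g(2) by (intro AE_I2) simp
    qed (auto simp: emeasure_space_1)
    then show "(\<lambda>n. \<integral>\<^sup>+ y. ennreal (q n y) * ennreal (g y) \<partial>\<mu>)
        \<longlonglongrightarrow> (\<integral>\<^sup>+ \<omega>. ennreal (g (\<epsilon> \<omega> + L x)) \<partial>P)"
      by (simp add: int_q)
    show "AE y in \<mu>. (\<lambda>n. ennreal (q n y)) \<longlonglongrightarrow> ennreal (p y)"
      using q_lim by eventually_elim (rule tendsto_ennrealI)
  qed (use g(2) total_q total_p in auto)
  have "\<mu>_shift (L x) = density \<mu> (\<lambda>y. ennreal (p y))"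
  proof (rule finite_borel_measure_eqI_continuous)
    show "finite_measure (\<mu>_shift (L x))"
      unfolding \<mu>_shift_def by (intro finite_measure_distr) measurable
    show "finite_measure (density \<mu> (\<lambda>y. ennreal (p y)))"
    proof (rule finite_measureI)
      have "(\<integral>\<^sup>+ y. 1 \<partial>density \<mu> (\<lambda>y. ennreal (p y))) = 1"
        by (subst nn_integral_density) (simp_all add: total_p)
      then show "emeasure (density \<mu> (\<lambda>y. ennreal (p y))) (space (density \<mu> (\<lambda>y. ennreal (p y)))) \<noteq> \<infinity>"
        by simp
    qed
    fix g :: "'g \<Rightarrow> real" assume g: "continuous_on UNIV g" "\<And>y. g y \<in> {0..1}"
    have [measurable]: "g \<in> borel_measurable borel"
      by (rule borel_measurable_continuous_onI[OF g(1)])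
    show "(\<integral>\<^sup>+ y. ennreal (g y) \<partial>\<mu>_shift (L x)) = (\<integral>\<^sup>+ y. ennreal (g y) \<partial>density \<mu> (\<lambda>y. ennreal (p y)))"
      unfolding \<mu>_shift_def by (simp add: nn_integral_distr nn_integral_density int_p[OF g])
  qed (simp_all add: \<mu>_def \<mu>_shift_def)
  then have "has_RN_deriv \<mu> (\<mu>_shift (L x)) p"
    using has_RN_deriv_density[OF \<mu>.sigma_finite_measure_axioms, of p] by simp
  moreover have "has_RN_deriv \<mu> (\<mu>_shift (\<Sum>i<n. a i x *\<^sub>R f i)) (q n)" for n
    using has_RN_deriv_density[OF \<mu>.sigma_finite_measure_axioms, of "q n"] truncated by simp
  \<comment> \<open>The infinite product is the limit of its partial products;
    \<open>prod_dividef\<close> rewrites each of these as the quotient \<open>q n y\<close>.\<close>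
  ultimately show ?thesis
    unfolding p_def[abs_def] q_def[abs_def] prod_dividef by blast
qed

end
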